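(* Consider the Schrödinger equation $\ddot x+p(t)x=0$ with potential $p(t)$. Define $$v(t)=1-p(t),$$ and let $(X(t),Y(t))$ be a path of the "magnetic" particle with prescribed speed $v(t)$, as defined in the context. Then the Schrödinger equation $\ddot x+p(t)x=0$ and the bike problem $\dot\theta=\dot Y\cos\theta-\dot X\sin\theta$ are equivalent, i.e. they transform into one another via the transformation $$\theta=2\arg(x+i\dot x)+\varphi ,\qquad\text{where}\quad \varphi(t)=t+\int_0^t p(\tau)\,d\tau .$$
   Context: Dots denote derivatives with respect to $t$. The "magnetic" particle: let $v=v(t)$ be a given function of time. A point mass $m=1$ moves in the plane (identified with $\mathbb{C}$) with speed $v$ and velocity vector $\mathbf{v}$, subject to normal acceleration due to the magnetic-like force $$\mathbf{F}=\mathbf{a}_\perp=i\,(2-v)\,\mathbf{v},$$ acting normal to the velocity $\mathbf{v}$ (multiplication by $i$ is rotation by $\pi/2$). The tangential velocity $v$ is prescribed, and the normal acceleration is determined by $v$. The function $v$ is allowed to change sign, so that $v=\pm|\mathbf{v}|$; if $v$ changes sign, the particle reverses its direction of motion. The bike problem: a segment $RF$ of constant length moves in the plane so that its front end $F$ follows a prescribed path $(X(t),Y(t))$, while the velocity of the rear end $R$ is constrained to the line $RF$. The angle $\theta$ between $RF$ and the $x$-axis then satisfies the differential equation $\dot\theta=\dot Y\cos\theta-\dot X\sin\theta$, which is the bike problem with front wheel path $(X,Y)$. In the transformation between $\theta$ and $x$, the solution $x$ is understood to be real and not identically zero, so that $x+i\dot x$ has an argument, and $\arg$ is followed continuously in 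$t$.
   Formalization: The path must start in direction i, or is first rotated so that it does (other initial directions make the formula false); on time intervals where v vanishes, the direction of motion is taken to keep turning at rate 2-v; p is continuous on the whole line. *)

theory Defs
  imports "HOL-Analysis.Analysis"
begin

definition schroedinger_solution :: "(real \<Rightarrow> real) \<Rightarrow> (real \<Rightarrow> real) \<Rightarrow> bool" where
  "schroedinger_solution p x \<longleftrightarrow>
     (\<forall>t. x differentiable (at t) \<and> deriv x differentiable (at t) \<and>
          deriv (deriv x) t + p t * x t = 0)"

definition bike_solution :: "(real \<Rightarrow> real) \<Rightarrow> (real \<Rightarrow> real) \<Rightarrow> (real \<Rightarrow> real) \<Rightarrow> bool" where
  "bike_solution X Y \<theta> \<longleftrightarrow>
     (\<forall>t. \<theta> differentiable (at t) \<and>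
          deriv \<theta> t = deriv Y t * cos (\<theta> t) - deriv X t * sin (\<theta> t))"

(* The magnetic-like force acting on a particle with velocity vector V. *)
definition magnetic_force :: "real \<Rightarrow> complex \<Rightarrow> complex" where
  "magnetic_force v V = \<i> * of_real (2 - v) * V"

(* A unit field u is the direction of motion: the velocity is v t *\<^sub>R u t, where the prescribed
   v may change sign; u itself is continuously differentiable, so that a sign change of v
   reverses the motion along the same tangent line.

   Third condition: the component of the acceleration along the unit normal \<i> * u t is that of
   the force. This component is the derivative, at s = t, of the velocity component along the
   fixed vector \<i> * u t; it is v t times the turning rate of u and exists even where v is only
   continuous. The tangential component of the acceleration is not constrained, v being given.

   Fourth condition: during a time interval in which v = 0 the force law reads 0 = 0 and
   would leave u arbitrary. By convention u then goes on turning at the rate 2 - v t at which the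
   force turns it whenever v t \<noteq> 0. The condition is void unless v vanishes on an
   interval; at all other zeros of v it follows from the continuity of the derivative of u. *)
definition magnetic_path ::
  "(real \<Rightarrow> real) \<Rightarrow> (real \<Rightarrow> complex) \<Rightarrow> (real \<Rightarrow> real) \<Rightarrow> (real \<Rightarrow> real) \<Rightarrow> bool" where
  "magnetic_path v u X Y \<longleftrightarrow>
     u C1_differentiable_on UNIV \<and> (\<forall>t. norm (u t) = 1) \<and>
     (\<forall>t. ((\<lambda>s. Complex (X s) (Y s)) has_vector_derivative v t *\<^sub>R u t) (at t)) \<and>
     (\<forall>t. ((\<lambda>s. (v s *\<^sub>R u s) \<bullet> (\<i> * u t)) has_real_derivative
            magnetic_force (v t) (v t *\<^sub>R u t) \<bullet> (\<i> * u t)) (at t)) \<and>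
     (\<forall>t \<in> interior {s. v s = 0}. (u has_vector_derivative \<i> * of_real (2 - v t) * u t) (at t))"

(* The interval integral is oriented, so t may be negative. *)
definition bike_phase :: "(real \<Rightarrow> real) \<Rightarrow> real \<Rightarrow> real" where
  "bike_phase p t = t + (LBINT \<tau>=ereal 0..ereal t. p \<tau>)"

(* \<theta> = 2 arg (x + \<i> x') + phase, for some continuous choice \<alpha> of the argument. *)
definition bike_transform :: "(real \<Rightarrow> real) \<Rightarrow> (real \<Rightarrow> real) \<Rightarrow> (real \<Rightarrow> real) \<Rightarrow> bool" where
  "bike_transform p x \<theta> \<longleftrightarrow>
     (\<exists>\<alpha>. continuous_on UNIV \<alpha> \<and>
          (\<forall>t. Complex (x t) (deriv x t) \<noteq> 0 \<and> is_Arg (Complex (x t) (deriv x t)) (\<alpha> t)) \<and>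
          (\<forall>t. \<theta> t = 2 * \<alpha> t + bike_phase p t))"

(* Every solution x not identically zero has transforms, and these solve the bike problem; every
   bike solution is the transform of such an x; and for a twice differentiable x and a transform
   \<theta> of it, x solves the one equation iff \<theta> solves the other. *)
definition transform_into_one_another ::
  "(real \<Rightarrow> real) \<Rightarrow> (real \<Rightarrow> real) \<Rightarrow> (real \<Rightarrow> real) \<Rightarrow> bool" where
  "transform_into_one_another p X Y \<longleftrightarrow>
     (\<forall>x. schroedinger_solution p x \<and> (\<exists>t. x t \<noteq> 0) \<longrightarrow>
          (\<exists>\<theta>. bike_transform p x \<theta> \<and> bike_solution X Y \<theta>)) \<and>
     (\<forall>\<theta>. bike_solution X Y \<theta> \<longrightarrow>
          (\<exists>x. schroedinger_solution p x \<and> (\<exists>t. x t \<noteq> 0) \<and> bike_transform p x \<theta>)) \<and>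
     (\<forall>x \<theta>. (\<forall>t. x differentiable (at t) \<and> deriv x differentiable (at t)) \<and>
          bike_transform p x \<theta> \<longrightarrow>
          (schroedinger_solution p x \<longleftrightarrow> bike_solution X Y \<theta>))"

end

theory Submission
  imports Defs
begin

text \<open>In polar form \<open>x + \<i> x' = r e\<^bsup>\<i>\<alpha>\<^esup>\<close>, the equation \<open>x'' + p x = 0\<close> reads
  \<open>\<alpha>' = - p cos\<^sup>2 \<alpha> - sin\<^sup>2 \<alpha>\<close>, \<open>r' = r (1 - p) sin \<alpha> cos \<alpha>\<close>; the first equation does not involve \<open>r\<close>,
  and once \<open>\<alpha>\<close> is known the second gives \<open>r\<close> up to a constant factor. The force law makes the direction of motion turn
  at the rate \<open>2 - v = 1 + p\<close>, so \<open>u = u(0) e\<^bsup>\<i>\<phi>\<^esup>\<close>, and for \<open>u(0) = \<i>\<close> the bike equation is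
  \<open>\<theta>' = (1 - p) cos (\<theta> - \<phi>)\<close>. Substituting \<open>\<theta> = 2\<alpha> + \<phi>\<close> turns this into the equation for \<open>\<alpha>\<close>.\<close>

section \<open>Antiderivatives on the line and the phase\<close>

lemma continuous_on_UNIV_antiderivative:
  fixes f :: "real \<Rightarrow> real"
  assumes "continuous_on UNIV f"
  obtains F where "\<And>t. (F has_real_derivative f t) (at t)"
proof -
  have "\<exists>F. \<forall>x :: real. -\<infinity> < ereal x \<longrightarrow> ereal x < \<infinity> \<longrightarrow> (F has_vector_derivative f x) (at x)"
    using assms by (intro einterval_antiderivative) (auto simp: continuous_on_eq_continuous_at)
  then show ?thesis
    using that by (auto simp: has_real_derivative_iff_has_vector_derivative)
qed

lemma bike_phase_has_real_derivative:
  assumes p: "continuous_on UNIV p"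
  shows "(bike_phase p has_real_derivative 1 + p t) (at t)"
proof -
  obtain F where F: "\<And>t. (F has_real_derivative p t) (at t)"
    using continuous_on_UNIV_antiderivative[OF p] by blast
  have "(LBINT \<tau>=ereal 0..ereal t. p \<tau>) = F t - F 0" for t
    using F p
    by (intro interval_integral_FTC_finite)
      (auto intro: continuous_on_subset has_field_derivative_at_within
        simp flip: has_real_derivative_iff_has_vector_derivative)
  then have "bike_phase p = (\<lambda>t. t + (F t - F 0))"
    by (auto simp: bike_phase_def)
  then show ?thesis
    by (auto intro!: derivative_eq_intros F)
qed

lemma bike_phase_0 [simp]: "bike_phase p 0 = 0"
  by (simp add: bike_phase_def)

section \<open>Solutions of the Schroedinger equation and their nonvanishing in the phase
  plane\<close>

lemma schroedinger_solutionD: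
  assumes "schroedinger_solution p x"
  shows "(x has_real_derivative deriv x t) (at t)"
    and "(deriv x has_real_derivative - p t * x t) (at t)"
proof -
  have "deriv x field_differentiable at t" "x field_differentiable at t" "deriv (deriv x) t = - p t * x t"
    using assms
    by (auto simp: schroedinger_solution_def real_differentiable_def field_differentiable_def
        add_eq_0_iff2)
  then show "(x has_real_derivative deriv x t) (at t)"
    "(deriv x has_real_derivative - p t * x t) (at t)"
    by (metis DERIV_deriv_iff_field_differentiable)+
qed

lemma schroedinger_solutionI:
  assumes x: "\<And>t. (x has_real_derivative y t) (at t)"
    and y: "\<And>t. (y has_real_derivative - p t * x t) (at t)"
  shows "schroedinger_solution p x"
proof -
  have "deriv x = y"
    using x by (auto intro: DERIV_imp_deriv)
  then show ?thesis
    using x y DERIV_imp_deriv[OF y]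
    by (auto simp: schroedinger_solution_def real_differentiable_def)
qed

text \<open>With \<open>K' = k\<close>, the bound makes \<open>E * exp K\<close> nondecreasing and
  \<open>E * exp (- K)\<close> nonincreasing. The second carries the zero at \<open>a\<close>
  forward in time, the first carries it backward.\<close>

lemma gronwall_zero:
  fixes E E' k :: "real \<Rightarrow> real"
  assumes k: "continuous_on UNIV k"
    and E: "\<And>t. (E has_real_derivative E' t) (at t)"
    and bound: "\<And>t. \<bar>E' t\<bar> \<le> k t * E t"
    and nonneg: "\<And>t. E t \<ge> 0"
    and zero: "E a = 0"
  shows "E t = 0"
proof -
  obtain K where K: "\<And>t. (K has_real_derivative k t) (at t)"
    using continuous_on_UNIV_antiderivative[OF k] by blast
  have mono: "E s * exp (K s) \<le> E t * exp (K t)" if "s \<le> t" for s t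
  proof (rule DERIV_nonneg_imp_nondecreasing[OF that])
    fix r
    have "((\<lambda>t. E t * exp (K t)) has_real_derivative (E' r + k r * E r) * exp (K r)) (at r)"
      by (auto intro!: derivative_eq_intros E K simp: algebra_simps)
    then show "\<exists>y. ((\<lambda>t. E t * exp (K t)) has_real_derivative y) (at r) \<and> 0 \<le> y"
      using bound[of r] by (intro exI conjI) (auto intro!: mult_nonneg_nonneg)
  qed
  have anti: "E t * exp (- K t) \<le> E s * exp (- K s)" if "s \<le> t" for s t
  proof (rule DERIV_nonpos_imp_nonincreasing[OF that])
    fix r
    have "((\<lambda>t. E t * exp (- K t)) has_real_derivative (E' r - k r * E r) * exp (- K r)) (at r)"
      by (auto intro!: derivative_eq_intros E K simp: algebra_simps)
    then show "\<exists>y. ((\<lambda>t. E t * exp (- K t)) has_real_derivative y) (at r) \<and> y \<le> 0"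
      using bound[of r] by (intro exI conjI) (auto intro!: mult_nonpos_nonneg)
  qed
  have "E t \<le> 0"
  proof (cases "a \<le> t")
    case True
    from anti[OF this] show ?thesis
      by (simp add: zero mult_le_0_iff)
  next
    case False
    with mono[of t a] show ?thesis
      by (simp add: zero mult_le_0_iff)
  qed
  with nonneg[of t] show ?thesis by simp
qed

text \<open>The squared radius \<open>x^2 + x'^2\<close> has derivative
  \<open>2 (1 - p) x x'\<close>, which is at most \<open>\<bar>1 - p\<bar>\<close> times itself in
  absolute value. By \<open>gronwall_zero\<close> a single zero of it would make it vanish at
  \<open>s\<close> as well.\<close>

lemma schroedinger_solution_nonzero:
  assumes p: "continuous_on UNIV p" and x: "schroedinger_solution p x" and "x s \<noteq> 0"
  shows "Complex (x t) (deriv x t) \<noteq> 0"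
proof
  assume "Complex (x t) (deriv x t) = 0"
  then have zero: "x t = 0" "deriv x t = 0"
    by (simp_all add: complex_eq_iff)
  have "(x s)\<^sup>2 + (deriv x s)\<^sup>2 = 0"
  proof (rule gronwall_zero[where k = "\<lambda>t. \<bar>1 - p t\<bar>" and E = "\<lambda>t. (x t)\<^sup>2 + (deriv x t)\<^sup>2" and a = t
        and E' = "\<lambda>t. (1 - p t) * (2 * (x t * deriv x t))"])
    show "continuous_on UNIV (\<lambda>t. \<bar>1 - p t\<bar>)"
      using p by (intro continuous_intros)
    show "((\<lambda>t. (x t)\<^sup>2 + (deriv x t)\<^sup>2) has_real_derivative (1 - p r) * (2 * (x r * deriv x r))) (at r)" for r
      by (auto intro!: derivative_eq_intros schroedinger_solutionD[OF x] simp: algebra_simps)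
    have "\<bar>2 * (x r * deriv x r)\<bar> \<le> (x r)\<^sup>2 + (deriv x r)\<^sup>2" for r
      using sum_squares_bound[of "\<bar>x r\<bar>" "\<bar>deriv x r\<bar>"] by (simp add: abs_mult)
    then show "\<bar>(1 - p r) * (2 * (x r * deriv x r))\<bar> \<le> \<bar>1 - p r\<bar> * ((x r)\<^sup>2 + (deriv x r)\<^sup>2)" for r
      by (metis abs_mult abs_ge_zero mult_left_mono)
  qed (auto simp: zero)
  with \<open>x s \<noteq> 0\<close> show False
    by (simp add: sum_power2_eq_zero_iff)
qed

section \<open>Continuous arguments of plane curves\<close>

lemma continuous_argument_exists:
  fixes z :: "real \<Rightarrow> complex"
  assumes "continuous_on UNIV z" "\<And>t. z t \<noteq> 0"
  obtains \<alpha> where "continuous_on UNIV \<alpha>" "\<And>t. is_Arg (z t) (\<alpha> t)"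
proof -
  \<comment> \<open>The line is contractible, so \<open>z\<close> has a continuous logarithm; its
    imaginary part is the argument.\<close>
  obtain g where g: "continuous_on UNIV g" "\<And>t. z t = exp (g t)"
    using assms continuous_logarithm_on_contractible[of UNIV z] by auto
  show ?thesis
  proof
    show "continuous_on UNIV (\<lambda>t. Im (g t))"
      using g by (intro continuous_intros)
    show "is_Arg (z t) (Im (g t))" for t
      by (simp add: g is_Arg_def exp_eq_polar norm_mult flip: cis_conv_exp)
  qed
qed

lemma is_Arg_Complex_iff:
  "is_Arg (Complex a b) \<alpha> \<longleftrightarrow>
    a = cmod (Complex a b) * cos \<alpha> \<and> b = cmod (Complex a b) * sin \<alpha>"
  by (simp add: is_Arg_def complex_eq_iff Re_exp Im_exp)

text \<open>Continuity of \<alpha> at \<open>t\<close> already yields differentiability: near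
  \<open>t\<close> it cannot jump by a multiple of \<open>2 * pi\<close>, so it agrees with an
  explicit arctangent that can be differentiated.\<close>

lemma continuous_argument_has_real_derivative:
  fixes x y \<alpha> :: "real \<Rightarrow> real"
  assumes \<alpha>: "isCont \<alpha> t"
    and arg: "\<And>s. is_Arg (Complex (x s) (y s)) (\<alpha> s)"
    and nz: "\<And>s. Complex (x s) (y s) \<noteq> 0"
    and x: "(x has_real_derivative x') (at t)"
    and y: "(y has_real_derivative y') (at t)"
  shows "(\<alpha> has_real_derivative (x t * y' - y t * x') / ((x t)\<^sup>2 + (y t)\<^sup>2)) (at t)"
proof -
  define R where "R = (\<lambda>s. cmod (Complex (x s) (y s)))"
  \<comment> \<open>\<open>a\<close> and \<open>b\<close> are the coordinates after rotation by
    \<open>- \<alpha> t\<close>. At time \<open>t\<close> the rotated curve is on the positive real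
    axis, where the arctangent of the slope is smooth.\<close>
  define a where "a = (\<lambda>s. x s * cos (\<alpha> t) + y s * sin (\<alpha> t))"
  define b where "b = (\<lambda>s. y s * cos (\<alpha> t) - x s * sin (\<alpha> t))"
  have R: "R s > 0" for s
    using nz by (simp add: R_def)
  have xy: "x s = R s * cos (\<alpha> s)" "y s = R s * sin (\<alpha> s)" for s
    using arg[of s] unfolding is_Arg_Complex_iff R_def by auto
  have ab: "a s = R s * cos (\<alpha> s - \<alpha> t)" "b s = R s * sin (\<alpha> s - \<alpha> t)" for s
    unfolding a_def b_def by (simp_all add: xy[of s] cos_diff sin_diff algebra_simps)
  have RR: "(R t)\<^sup>2 = (x t)\<^sup>2 + (y t)\<^sup>2"
    by (simp add: R_def cmod_power2)
  have at: "a t = R t" "b t = 0"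
    by (simp_all add: ab)
  have a': "(a has_real_derivative x' * cos (\<alpha> t) + y' * sin (\<alpha> t)) (at t)"
    unfolding a_def by (auto intro!: derivative_eq_intros x y)
  have b': "(b has_real_derivative y' * cos (\<alpha> t) - x' * sin (\<alpha> t)) (at t)"
    unfolding b_def by (auto intro!: derivative_eq_intros x y)
  have "((\<lambda>s. \<alpha> t + arctan (b s / a s)) has_real_derivative
      (y' * cos (\<alpha> t) - x' * sin (\<alpha> t)) / R t) (at t)"
    by (rule derivative_eq_intros a' b' refl)+ (use at R[of t] in auto)
  moreover have "(y' * cos (\<alpha> t) - x' * sin (\<alpha> t)) / R t
      = (x t * y' - y t * x') / ((x t)\<^sup>2 + (y t)\<^sup>2)"
    unfolding RR[symmetric] using R[of t] by (simp add: xy[of t] field_simps power2_eq_square)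
  moreover have "eventually (\<lambda>s. \<alpha> s = \<alpha> t + arctan (b s / a s)) (nhds t)"
  proof -
    \<comment> \<open>Within \<open>pi / 2\<close> the difference of the angles lies in the branch
      on which \<open>arctan\<close> inverts \<open>tan\<close>.\<close>
    have "eventually (\<lambda>s. dist (\<alpha> s) (\<alpha> t) < pi / 2) (nhds t)"
      using \<alpha> by (intro tendstoD) (simp_all add: continuous_at tendsto_at_iff_tendsto_nhds)
    then show ?thesis
    proof eventually_elim
      case (elim s)
      have "b s / a s = tan (\<alpha> s - \<alpha> t)"
        using R[of s] by (simp add: ab tan_def)
      moreover have "arctan (tan (\<alpha> s - \<alpha> t)) = \<alpha> s - \<alpha> t"
        using elim by (intro arctan_tan) (simp_all only: dist_real_def abs_less_iff, linarith+)
      ultimately show ?case by simp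
    qed
  qed
  ultimately show ?thesis
    by (simp add: DERIV_cong_ev[OF refl _ refl])
qed

section \<open>Derivatives at exceptional points\<close>

lemma has_real_derivative_limit_eq:
  fixes f f' g :: "real \<Rightarrow> real"
  assumes f: "\<And>s. (f has_real_derivative f' s) (at s)"
    and ev: "eventually (\<lambda>s. f' s = g s) (at t)"
    and g: "isCont g t"
  shows "f' t = g t"
proof -
  have "((\<lambda>s. f s - f t) \<longlongrightarrow> 0) (at t)" "((\<lambda>s. s - t) \<longlongrightarrow> 0) (at t)"
    using DERIV_isCont[OF f, of t] by (auto simp: isCont_def intro!: tendsto_eq_intros)
  \<comment> \<open>By l'Hopital the difference quotient has the limit of \<open>f'\<close> over the
    punctured neighbourhood, which is \<open>g t\<close>; continuity of \<open>f'\<close> at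
    \<open>t\<close> is not presupposed.\<close>
  then have "((\<lambda>s. (f s - f t) / (s - t)) \<longlongrightarrow> g t) (at t)"
  proof (rule lhopital[where f' = f' and g' = "\<lambda>_. 1"])
    show "eventually (\<lambda>s. s - t \<noteq> 0) (at t)"
      by (auto simp: eventually_at_filter)
    have "((\<lambda>s. f' s) \<longlongrightarrow> g t) (at t) \<longleftrightarrow> (g \<longlongrightarrow> g t) (at t)"
      by (rule tendsto_cong[OF ev])
    then show "((\<lambda>s. f' s / 1) \<longlongrightarrow> g t) (at t)"
      using g by (simp add: isCont_def)
  qed (auto intro!: derivative_eq_intros f always_eventually)
  moreover have "((\<lambda>s. (f s - f t) / (s - t)) \<longlongrightarrow> f' t) (at t)"
    using f[of t] by (simp add: has_field_derivative_iff)
  ultimately show ?thesis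
    using tendsto_unique trivial_limit_at by blast
qed

text \<open>The difference quotient at \<open>t\<close> would be zero at every other zero of
  \<open>f\<close>, but near \<open>t\<close> it is close to \<open>D\<close>.\<close>

lemma has_real_derivative_zero_isolated:
  fixes f :: "real \<Rightarrow> real"
  assumes "(f has_real_derivative D) (at t)" "D \<noteq> 0" "f t = 0"
  shows "eventually (\<lambda>s. f s \<noteq> 0) (at t)"
proof -
  have "((\<lambda>s. (f s - f t) / (s - t)) \<longlongrightarrow> D) (at t)"
    using assms by (simp add: has_field_derivative_iff)
  from tendsto_imp_eventually_ne[OF this \<open>D \<noteq> 0\<close>] show ?thesis
    by eventually_elim (auto simp: \<open>f t = 0\<close>)
qed

section \<open>The angular bike equation and its equivalence with the Schroedinger equation\<close>

definition angular_bike_solution :: "(real \<Rightarrow> real) \<Rightarrow> (real \<Rightarrow> real) \<Rightarrow> bool" where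
  "angular_bike_solution p \<theta> \<longleftrightarrow>
    (\<forall>t. (\<theta> has_real_derivative (1 - p t) * cos (\<theta> t - bike_phase p t)) (at t))"

text \<open>The hypotheses describe a path with velocity
  \<open>(1 - p) * \<i> * cis (bike_phase p t)\<close>; the subtraction formula for the cosine then
  collapses the right side of the bike equation.\<close>

lemma bike_solution_iff_angular:
  assumes X: "\<And>t. (X has_real_derivative - (1 - p t) * sin (bike_phase p t)) (at t)"
    and Y: "\<And>t. (Y has_real_derivative (1 - p t) * cos (bike_phase p t)) (at t)"
  shows "bike_solution X Y \<theta> \<longleftrightarrow> angular_bike_solution p \<theta>"
proof -
  have "deriv Y t * cos (\<theta> t) - deriv X t * sin (\<theta> t) = (1 - p t) * cos (\<theta> t - bike_phase p t)" for t
    by (simp add: DERIV_imp_deriv[OF X] DERIV_imp_deriv[OF Y] cos_diff algebra_simps)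
  moreover have "\<theta> differentiable at t \<and> deriv \<theta> t = D \<longleftrightarrow> (\<theta> has_real_derivative D) (at t)" for t D
    by (metis DERIV_imp_deriv real_differentiable_def)
  ultimately show ?thesis
    by (simp add: bike_solution_def angular_bike_solution_def)
qed

text \<open>The left side is the derivative of \<open>2 * \<alpha> + bike_phase p\<close> when
  \<alpha> obeys the angle equation, the right side is that of the bike equation with
  \<open>\<theta> - bike_phase p = 2 * \<alpha>\<close>.\<close>

lemma riccati_angle_identity:
  "2 * (- p * (cos a)\<^sup>2 - (sin a)\<^sup>2) + (1 + p) = (1 - p) * cos (2 * a)" for a p :: real
  unfolding cos_double_cos sin_squared_eq by (simp add: algebra_simps)

lemma angular_bike_solution_iff:
  assumes p: "continuous_on UNIV p" and \<theta>: "\<And>t. \<theta> t = 2 * \<alpha> t + bike_phase p t"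
  shows "angular_bike_solution p \<theta> \<longleftrightarrow>
    (\<forall>t. (\<alpha> has_real_derivative - p t * (cos (\<alpha> t))\<^sup>2 - (sin (\<alpha> t))\<^sup>2) (at t))"
proof -
  have \<phi>: "(bike_phase p has_real_derivative 1 + p t) (at t)" for t
    by (rule bike_phase_has_real_derivative[OF p])
  have "(\<theta> has_real_derivative (1 - p t) * cos (\<theta> t - bike_phase p t)) (at t) \<longleftrightarrow>
    (\<alpha> has_real_derivative - p t * (cos (\<alpha> t))\<^sup>2 - (sin (\<alpha> t))\<^sup>2) (at t)" (is "?L \<longleftrightarrow> ?R") for t
  proof
    assume ?L
    from DERIV_cdivide[OF DERIV_diff[OF this \<phi>], of 2]
    have "((\<lambda>t. (\<theta> t - bike_phase p t) / 2) has_real_derivative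
      - p t * (cos (\<alpha> t))\<^sup>2 - (sin (\<alpha> t))\<^sup>2) (at t)"
      by (rule DERIV_cong)
        (use riccati_angle_identity[of "p t" "\<alpha> t"] in \<open>simp add: \<theta>\<close>)
    then show ?R by (simp add: \<theta>)
  next
    assume ?R
    from DERIV_add[OF DERIV_cmult[OF this, of 2] \<phi>]
    have "((\<lambda>t. 2 * \<alpha> t + bike_phase p t) has_real_derivative (1 - p t) * cos (2 * \<alpha> t)) (at t)"
      unfolding riccati_angle_identity .
    moreover have "\<theta> = (\<lambda>t. 2 * \<alpha> t + bike_phase p t)" using \<theta> by auto
    ultimately show ?L by simp
  qed
  then show ?thesis by (simp add: angular_bike_solution_def)
qed

text \<open>The actual derivative of \<alpha> exceeds the one demanded by the angle equation by
  \<open>x (x'' + p x) / R^2\<close>. This settles the equivalence wherever \<open>x\<close> is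
  nonzero; its zeros need a separate argument.\<close>

lemma schroedinger_iff_angular_bike:
  assumes p: "continuous_on UNIV p"
    and diff: "\<And>t. x differentiable (at t)" "\<And>t. deriv x differentiable (at t)"
    and T: "bike_transform p x \<theta>"
  shows "schroedinger_solution p x \<longleftrightarrow> angular_bike_solution p \<theta>"
proof -
  obtain \<alpha> where \<alpha>: "continuous_on UNIV \<alpha>"
    and nz: "\<And>t. Complex (x t) (deriv x t) \<noteq> 0"
    and arg: "\<And>t. is_Arg (Complex (x t) (deriv x t)) (\<alpha> t)"
    and \<theta>: "\<And>t. \<theta> t = 2 * \<alpha> t + bike_phase p t"
    using T unfolding bike_transform_def by auto
  define R where "R = (\<lambda>t. cmod (Complex (x t) (deriv x t)))"
  have R: "R t > 0" for t
    using nz by (simp add: R_def)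
  have x: "x t = R t * cos (\<alpha> t)" "deriv x t = R t * sin (\<alpha> t)" for t
    using arg[of t] unfolding is_Arg_Complex_iff R_def by auto
  have RR: "(x t)\<^sup>2 + (deriv x t)\<^sup>2 = (R t)\<^sup>2" for t
    by (simp add: R_def cmod_power2)
  have x': "(x has_real_derivative deriv x t) (at t)" for t
    using diff(1) by (metis DERIV_imp_deriv real_differentiable_def)
  have x'': "(deriv x has_real_derivative deriv (deriv x) t) (at t)" for t
    using diff(2) by (metis DERIV_imp_deriv real_differentiable_def)
  define A where "A = (\<lambda>t. (x t * deriv (deriv x) t - deriv x t * deriv x t) / (R t)\<^sup>2)"
  have \<alpha>': "(\<alpha> has_real_derivative A t) (at t)" for t
    unfolding A_def RR[symmetric]
    by (rule continuous_argument_has_real_derivative[OF _ arg nz x' x''])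
      (use \<alpha> in \<open>auto simp: continuous_on_eq_continuous_at\<close>)
  have A: "A t = - p t * (cos (\<alpha> t))\<^sup>2 - (sin (\<alpha> t))\<^sup>2 \<longleftrightarrow> x t * (deriv (deriv x) t + p t * x t) = 0" for t
  proof -
    have "- p t * (cos (\<alpha> t))\<^sup>2 - (sin (\<alpha> t))\<^sup>2 = (- p t * (x t)\<^sup>2 - (deriv x t)\<^sup>2) / (R t)\<^sup>2"
      using R[of t] by (simp add: x[of t] field_simps)
    then have "A t = - p t * (cos (\<alpha> t))\<^sup>2 - (sin (\<alpha> t))\<^sup>2 \<longleftrightarrow>
      x t * deriv (deriv x) t - deriv x t * deriv x t = - p t * (x t)\<^sup>2 - (deriv x t)\<^sup>2"
      using R[of t] by (simp add: A_def)
    then show ?thesis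
      by (auto simp: algebra_simps power2_eq_square)
  qed
  have "angular_bike_solution p \<theta> \<longleftrightarrow> (\<forall>t. A t = - p t * (cos (\<alpha> t))\<^sup>2 - (sin (\<alpha> t))\<^sup>2)"
    unfolding angular_bike_solution_iff[OF p \<theta>] by (metis \<alpha>' DERIV_unique)
  also have "\<dots> \<longleftrightarrow> (\<forall>t. x t = 0 \<or> deriv (deriv x) t + p t * x t = 0)"
    unfolding A by simp
  also have "\<dots> \<longleftrightarrow> (\<forall>t. deriv (deriv x) t = - p t * x t)"
  proof safe
    fix t
    assume *: "\<forall>t. x t = 0 \<or> deriv (deriv x) t + p t * x t = 0"
    show "deriv (deriv x) t = - p t * x t"
      \<comment> \<open>At a zero of \<open>x\<close> the equation for \<open>\<alpha>\<close> says nothing about \<open>x''\<close>. Such zeros are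
        isolated, and a derivative has no removable discontinuity.\<close>
    proof (cases "x t = 0")
      case True
      with nz[of t] have "deriv x t \<noteq> 0" by (auto simp: complex_eq_iff)
      from has_real_derivative_zero_isolated[OF x' this True]
      have ev: "eventually (\<lambda>s. deriv (deriv x) s = - p s * x s) (at t)"
        by eventually_elim (use * in \<open>auto simp: add_eq_0_iff2\<close>)
      show ?thesis
      proof (rule has_real_derivative_limit_eq[OF x'' ev])
        show "isCont (\<lambda>s. - p s * x s) t"
          using p DERIV_isCont[OF x'] by (auto intro!: continuous_intros simp: continuous_on_eq_continuous_at)
      qed
    next
      case False
      with * show ?thesis by (auto simp: add_eq_0_iff2)
    qed
  qed auto
  also have "\<dots> \<longleftrightarrow> schroedinger_solution p x"
    using diff by (auto simp: schroedinger_solution_def add_eq_0_iff2)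
  finally show ?thesis ..
qed

lemma schroedinger_solution_from_angular_bike:
  assumes p: "continuous_on UNIV p" and \<theta>: "angular_bike_solution p \<theta>"
  obtains x s where "schroedinger_solution p x" "x s \<noteq> 0" "bike_transform p x \<theta>"
proof -
  define \<alpha> where "\<alpha> = (\<lambda>t. (\<theta> t - bike_phase p t) / 2)"
  have \<theta>\<alpha>: "\<theta> t = 2 * \<alpha> t + bike_phase p t" for t
    by (simp add: \<alpha>_def field_simps)
  have \<alpha>': "(\<alpha> has_real_derivative - p t * (cos (\<alpha> t))\<^sup>2 - (sin (\<alpha> t))\<^sup>2) (at t)" for t
    using \<theta> angular_bike_solution_iff[OF p \<theta>\<alpha>] by simp
  have \<alpha>: "continuous_on UNIV \<alpha>"
    using \<alpha>' DERIV_isCont by (auto simp: continuous_on_eq_continuous_at)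
  \<comment> \<open>This function is \<open>r' / r\<close> in the radial equation, so
    \<open>exp (L t)\<close> below serves as the radius.\<close>
  have "continuous_on UNIV (\<lambda>t. (1 - p t) * (sin (\<alpha> t) * cos (\<alpha> t)))"
    using p \<alpha> by (intro continuous_intros)
  then obtain L where L: "\<And>t. (L has_real_derivative (1 - p t) * (sin (\<alpha> t) * cos (\<alpha> t))) (at t)"
    using continuous_on_UNIV_antiderivative by blast
  define x where "x = (\<lambda>t. exp (L t) * cos (\<alpha> t))"
  define y where "y = (\<lambda>t. exp (L t) * sin (\<alpha> t))"
  have x': "(x has_real_derivative y t) (at t)" for t
    unfolding x_def
  proof (rule DERIV_cong)
    show "((\<lambda>t. exp (L t) * cos (\<alpha> t)) has_real_derivative
      exp (L t) * ((1 - p t) * (sin (\<alpha> t) * cos (\<alpha> t))) * cos (\<alpha> t) +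
      exp (L t) * (- sin (\<alpha> t) * (- p t * (cos (\<alpha> t))\<^sup>2 - (sin (\<alpha> t))\<^sup>2))) (at t)"
      by (rule derivative_eq_intros L \<alpha>' refl)+ simp
    \<comment> \<open>The two terms with \<open>p\<close> cancel, leaving
      \<open>exp L * sin \<alpha>\<close> times \<open>cos^2 + sin^2\<close>.\<close>
    show "exp (L t) * ((1 - p t) * (sin (\<alpha> t) * cos (\<alpha> t))) * cos (\<alpha> t) +
      exp (L t) * (- sin (\<alpha> t) * (- p t * (cos (\<alpha> t))\<^sup>2 - (sin (\<alpha> t))\<^sup>2)) = y t"
      unfolding y_def using sin_cos_squared_add[of "\<alpha> t"] by algebra
  qed
  have y': "(y has_real_derivative - p t * x t) (at t)" for t
    unfolding y_def
  proof (rule DERIV_cong)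
    show "((\<lambda>t. exp (L t) * sin (\<alpha> t)) has_real_derivative
      exp (L t) * ((1 - p t) * (sin (\<alpha> t) * cos (\<alpha> t))) * sin (\<alpha> t) +
      exp (L t) * (cos (\<alpha> t) * (- p t * (cos (\<alpha> t))\<^sup>2 - (sin (\<alpha> t))\<^sup>2))) (at t)"
      by (rule derivative_eq_intros L \<alpha>' refl)+ simp
    show "exp (L t) * ((1 - p t) * (sin (\<alpha> t) * cos (\<alpha> t))) * sin (\<alpha> t) +
      exp (L t) * (cos (\<alpha> t) * (- p t * (cos (\<alpha> t))\<^sup>2 - (sin (\<alpha> t))\<^sup>2)) = - p t * x t"
      unfolding x_def using sin_cos_squared_add[of "\<alpha> t"] by algebra
  qed
  have xy: "Complex (x t) (y t) = exp (L t) * exp (\<i> * \<alpha> t)" for t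
    by (simp add: x_def y_def complex_eq_iff Re_exp Im_exp flip: exp_of_real)
  have dx: "deriv x = y"
    using x' by (auto intro: DERIV_imp_deriv)
  have T: "bike_transform p x \<theta>"
    unfolding bike_transform_def
  proof (intro exI[of _ \<alpha>] conjI allI \<alpha> \<theta>\<alpha>)
    fix t
    show "Complex (x t) (deriv x t) \<noteq> 0"
      by (simp add: dx xy)
    show "is_Arg (Complex (x t) (deriv x t)) (\<alpha> t)"
      by (simp add: dx xy is_Arg_def norm_mult)
  qed
  \<comment> \<open>If \<open>x\<close> vanished identically, so would its derivative
    \<open>y\<close>, although the radius \<open>exp (L t)\<close> is positive.\<close>
  have "\<exists>s. x s \<noteq> 0"
  proof (rule ccontr)
    assume "\<nexists>s. x s \<noteq> 0"
    then have "x = (\<lambda>_. 0)" by auto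
    then have "x 0 = 0" "y 0 = 0" by (simp_all flip: dx)
    then have "Complex (x 0) (y 0) = 0" by (simp add: complex_eq_iff)
    with xy[of 0] show False by simp
  qed
  then show ?thesis
    using that schroedinger_solutionI[OF x' y'] T by blast
qed

text \<open>The path enters the three clauses only through its bike solutions, so it can be replaced
  by the angular equation. For the first clause a continuous argument must be supplied; it exists
  because \<open>x + \<i> x'\<close> never vanishes.\<close>

lemma transform_into_one_another_if_angular:
  assumes p: "continuous_on UNIV p"
    and bike: "\<And>\<theta>. bike_solution X Y \<theta> \<longleftrightarrow> angular_bike_solution p \<theta>"
  shows "transform_into_one_another p X Y"
  unfolding transform_into_one_another_def bike
proof (intro conjI allI impI)
  fix x
  assume *: "schroedinger_solution p x \<and> (\<exists>t. x t \<noteq> 0)"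
  then have x: "\<And>t. x differentiable (at t)" "\<And>t. deriv x differentiable (at t)"
    by (auto simp: schroedinger_solution_def)
  have nz: "Complex (x t) (deriv x t) \<noteq> 0" for t
    using * schroedinger_solution_nonzero[OF p] by blast
  have "continuous_on UNIV (\<lambda>t. Complex (x t) (deriv x t))"
    using * by (intro continuous_on_Complex)
      (auto intro!: DERIV_isCont schroedinger_solutionD simp: continuous_on_eq_continuous_at)
  from continuous_argument_exists[OF this nz] obtain \<alpha> where
    "continuous_on UNIV \<alpha>" "\<And>t. is_Arg (Complex (x t) (deriv x t)) (\<alpha> t)"
    by blast
  with nz have "bike_transform p x (\<lambda>t. 2 * \<alpha> t + bike_phase p t)"
    by (auto simp: bike_transform_def)
  with * show "\<exists>\<theta>. bike_transform p x \<theta> \<and> angular_bike_solution p \<theta>"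
    using schroedinger_iff_angular_bike[OF p x] by blast
next
  fix \<theta>
  assume "angular_bike_solution p \<theta>"
  then show "\<exists>x. schroedinger_solution p x \<and> (\<exists>t. x t \<noteq> 0) \<and> bike_transform p x \<theta>"
    using schroedinger_solution_from_angular_bike[OF p] by metis
next
  fix x \<theta>
  assume "(\<forall>t. x differentiable (at t) \<and> deriv x differentiable (at t)) \<and> bike_transform p x \<theta>"
  then show "schroedinger_solution p x \<longleftrightarrow> angular_bike_solution p \<theta>"
    using schroedinger_iff_angular_bike[OF p] by blast
qed

section \<open>The direction of motion of the magnetic particle\<close>

lemma unit_orthogonal_complex:
  assumes "norm u = 1" "D \<bullet> u = 0"
  shows "D = \<i> * of_real (D \<bullet> (\<i> * u)) * u"
proof -
  have u: "Re u * Re u + Im u * Im u = 1"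
    using assms(1) cmod_power2[of u] by (simp add: power2_eq_square)
  have o: "Re D * Re u + Im D * Im u = 0"
    using assms(2) by (simp add: inner_complex_def)
  \<comment> \<open>The bracket is the inner product of \<open>D\<close> with
    \<open>\<i> * u\<close>, the only component left in the orthonormal basis \<open>u\<close>,
    \<open>\<i> * u\<close>.\<close>
  have "Re D = (Im D * Re u - Re D * Im u) * - Im u" "Im D = (Im D * Re u - Re D * Im u) * Re u"
    using u o by algebra+
  then show ?thesis
    by (simp add: complex_eq_iff inner_complex_def algebra_simps)
qed

text \<open>A product rule for merely continuous \<open>v\<close>: since \<open>g t = 0\<close>, the
  difference quotient of the product is \<open>v s\<close> times that of \<open>g\<close>.\<close>

lemma has_real_derivative_mult_continuous_zero:
  fixes v g :: "real \<Rightarrow> real"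
  assumes "isCont v t" "(g has_real_derivative D) (at t)" "g t = 0"
  shows "((\<lambda>s. v s * g s) has_real_derivative v t * D) (at t)"
proof -
  have "((\<lambda>s. v s * ((g s - g t) / (s - t))) \<longlongrightarrow> v t * D) (at t)"
    using assms by (intro tendsto_mult) (auto simp: isCont_def has_field_derivative_iff)
  then show ?thesis
    by (simp add: has_field_derivative_iff \<open>g t = 0\<close>)
qed

text \<open>The coincidence set of \<open>f\<close> and \<open>g\<close> is closed, and the
  complement of the interior of the zero set of \<open>v\<close> is the closure of the set where
  \<open>v\<close> is nonzero.\<close>

lemma eq_on_closure_of_nonzero:
  fixes f g v :: "real \<Rightarrow> real"
  assumes "continuous_on UNIV f" "continuous_on UNIV g"
    and "\<And>t. v t \<noteq> 0 \<Longrightarrow> f t = g t" and "t \<notin> interior {s. v s = 0}"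
  shows "f t = g t"
proof -
  have "{s. v s \<noteq> 0} \<subseteq> {s. f s = g s}" using assms(3) by auto
  moreover have "closed {s. f s = g s}"
    using assms(1,2) by (intro closed_Collect_eq)
  ultimately have "closure {s. v s \<noteq> 0} \<subseteq> {s. f s = g s}"
    by (rule closure_minimal)
  moreover have "t \<in> closure {s. v s \<noteq> 0}"
    using assms(4) by (simp add: interior_closure Compl_eq)
  ultimately show ?thesis by blast
qed

text \<open>Constant norm makes the derivative of \<open>u\<close> normal to \<open>u\<close>, so
  only the turning rate is to be found. Where \<open>v t \<noteq> 0\<close> the force law gives it
  after cancelling \<open>v t\<close>; continuity of the derivative extends this to the closure of
  such times, and the convention in \<open>magnetic_path\<close> covers the remaining ones.\<close>

lemma magnetic_path_turning_rate:
  assumes v: "continuous_on UNIV v" and path: "magnetic_path v u X Y"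
  shows "(u has_vector_derivative \<i> * of_real (2 - v t) * u t) (at t)"
proof -
  have unit: "norm (u t) = 1" for t
    using path by (simp add: magnetic_path_def)
  obtain D where D: "\<And>t. (u has_vector_derivative D t) (at t)" and D_cont: "continuous_on UNIV D"
    using path by (auto simp: magnetic_path_def C1_differentiable_on_def)
  have u_cont: "continuous_on UNIV u"
    using has_vector_derivative_continuous[OF D] by (simp add: continuous_on_eq_continuous_at)
  have inner: "((\<lambda>s. u s \<bullet> w) has_real_derivative D t \<bullet> w) (at t)" for w t
    using bounded_linear.has_vector_derivative[OF bounded_linear_inner_left D]
    by (simp add: has_real_derivative_iff_has_vector_derivative)
  have "D t \<bullet> u t = 0" for t
  proof -
    have "((\<lambda>s. u s \<bullet> u s) has_vector_derivative u t \<bullet> D t + D t \<bullet> u t) (at t)"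
      by (rule bounded_bilinear.has_vector_derivative[OF bounded_bilinear_inner D D])
    moreover have "(\<lambda>s. u s \<bullet> u s) = (\<lambda>_. 1)"
      using unit by (simp add: dot_square_norm)
    ultimately have "u t \<bullet> D t + D t \<bullet> u t = 0"
      using vector_derivative_unique_at has_vector_derivative_const by metis
    then show ?thesis by (simp add: inner_commute)
  qed
  then have D_eq: "D t = \<i> * of_real (D t \<bullet> (\<i> * u t)) * u t" for t
    using unit unit_orthogonal_complex by blast
  have iu: "(\<i> * u t) \<bullet> (\<i> * u t) = 1" for t
    by (simp add: dot_square_norm norm_mult unit)
  have nonzero: "D t \<bullet> (\<i> * u t) = 2 - v t" if "v t \<noteq> 0" for t
  proof -
    have "((\<lambda>s. (v s *\<^sub>R u s) \<bullet> (\<i> * u t)) has_real_derivative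
        magnetic_force (v t) (v t *\<^sub>R u t) \<bullet> (\<i> * u t)) (at t)"
      using path by (simp add: magnetic_path_def)
    moreover have "magnetic_force (v t) (v t *\<^sub>R u t) = ((2 - v t) * v t) *\<^sub>R (\<i> * u t)"
      by (simp add: magnetic_force_def scaleR_conv_of_real)
    ultimately have "((\<lambda>s. v s * (u s \<bullet> (\<i> * u t))) has_real_derivative (2 - v t) * v t) (at t)"
      by (simp only: inner_scaleR_left iu mult_1_right)
    moreover have "((\<lambda>s. v s * (u s \<bullet> (\<i> * u t))) has_real_derivative v t * (D t \<bullet> (\<i> * u t))) (at t)"
    proof (rule has_real_derivative_mult_continuous_zero[OF _ inner])
      show "isCont v t" using v by (simp add: continuous_on_eq_continuous_at)
      show "u t \<bullet> (\<i> * u t) = 0" by (simp add: inner_complex_def)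
    qed
    ultimately have "(2 - v t) * v t = v t * (D t \<bullet> (\<i> * u t))"
      by (rule DERIV_unique)
    with that show ?thesis by simp
  qed
  show ?thesis
  proof (cases "t \<in> interior {s. v s = 0}")
    case True
    then show ?thesis using path by (simp add: magnetic_path_def)
  next
    case False
    have "D t \<bullet> (\<i> * u t) = 2 - v t"
      by (rule eq_on_closure_of_nonzero[OF _ _ nonzero False])
        (use v D_cont u_cont in \<open>auto intro!: continuous_intros\<close>)
    with D_eq[of t] D[of t] show ?thesis by simp
  qed
qed

text \<open>The integrating factor \<open>cis (- \<phi> t)\<close> turns \<open>u\<close> into a
  function with zero derivative, hence a constant.\<close>

lemma cis_rate_unique:
  fixes u :: "real \<Rightarrow> complex"
  assumes u: "\<And>t. (u has_vector_derivative \<i> * of_real (f t) * u t) (at t)"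
    and \<phi>: "\<And>t. (\<phi> has_real_derivative f t) (at t)" and "\<phi> 0 = 0"
  shows "u t = u 0 * cis (\<phi> t)"
proof -
  have "((\<lambda>t. cis (- \<phi> t)) has_vector_derivative - (\<i> * of_real (f t) * cis (- \<phi> t))) (at t)" for t
    using has_derivative_cis[OF DERIV_minus[OF \<phi>, unfolded has_field_derivative_def]]
    by (simp add: has_vector_derivative_def scaleR_conv_of_real mult_ac)
  from has_vector_derivative_mult[OF u this]
  have "((\<lambda>t. u t * cis (- \<phi> t)) has_vector_derivative 0) (at t within UNIV)" for t
    by (simp add: algebra_simps)
  from has_vector_derivative_zero_constant[OF convex_UNIV this]
  obtain c where "\<And>t. u t * cis (- \<phi> t) = c" by auto
  then have "u t * cis (- \<phi> t) * cis (\<phi> t) = u 0 * cis (- \<phi> 0) * cis (\<phi> t)" by simp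
  then show ?thesis
    by (simp add: \<open>\<phi> 0 = 0\<close> mult.assoc cis_mult)
qed

text \<open>The phase vanishes at time 0, so the transformation is matched to the initial direction
  \<open>\<i>\<close>. A path with another initial direction is brought into this position by the
  rotation \<open>\<i> / u 0\<close>.\<close>

theorem theorem2:
  fixes p v X Y :: "real \<Rightarrow> real" and u :: "real \<Rightarrow> complex"
  assumes "continuous_on UNIV p"
    and "\<And>t. v t = 1 - p t"
    and "magnetic_path v u X Y"
  shows "(u 0 = \<i> \<longrightarrow> transform_into_one_another p X Y) \<and>
         transform_into_one_another p
           (\<lambda>t. Re (\<i> / u 0 * Complex (X t) (Y t)))
           (\<lambda>t. Im (\<i> / u 0 * Complex (X t) (Y t)))"
proof -
  note p = assms(1) and v = assms(2) and path = assms(3)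
  have "v = (\<lambda>t. 1 - p t)" using v by auto
  then have "continuous_on UNIV v"
    using p by (auto intro: continuous_intros)
  from magnetic_path_turning_rate[OF this path]
  have u': "(u has_vector_derivative \<i> * of_real (1 + p t) * u t) (at t)" for t
    by (simp add: v)
  have u: "u t = u 0 * cis (bike_phase p t)" for t
    by (rule cis_rate_unique[OF u' bike_phase_has_real_derivative[OF p] bike_phase_0])
  have "norm (u 0) = 1"
    using path by (simp add: magnetic_path_def)
  then have u0: "u 0 \<noteq> 0" by auto
  \<comment> \<open>Since \<open>u t = u 0 * cis (bike_phase p t)\<close>, the rotated path moves
    along \<open>\<i> * cis (bike_phase p t)\<close>. For \<open>u 0 = \<i>\<close> the factor is 1,
    so both conjuncts follow from the result for \<open>Z\<close>.\<close>
  define Z where "Z = (\<lambda>t. \<i> / u 0 * Complex (X t) (Y t))"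
  have Z: "(Z has_vector_derivative (1 - p t) *\<^sub>R (\<i> * cis (bike_phase p t))) (at t)" for t
  proof -
    have "((\<lambda>t. Complex (X t) (Y t)) has_vector_derivative v t *\<^sub>R u t) (at t)"
      using path by (simp add: magnetic_path_def)
    from has_vector_derivative_mult_right[OF this, of "\<i> / u 0"] show ?thesis
      using u0 u[of t] by (simp add: Z_def v scaleR_conv_of_real mult_ac)
  qed
  have "transform_into_one_another p (\<lambda>t. Re (Z t)) (\<lambda>t. Im (Z t))"
  proof (intro transform_into_one_another_if_angular[OF p] bike_solution_iff_angular)
    show "((\<lambda>t. Re (Z t)) has_real_derivative - (1 - p t) * sin (bike_phase p t)) (at t)" for t
      using bounded_linear.has_vector_derivative[OF bounded_linear_Re Z[of t]]
      by (simp add: has_real_derivative_iff_has_vector_derivative algebra_simps)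
    show "((\<lambda>t. Im (Z t)) has_real_derivative (1 - p t) * cos (bike_phase p t)) (at t)" for t
      using bounded_linear.has_vector_derivative[OF bounded_linear_Im Z[of t]]
      by (simp add: has_real_derivative_iff_has_vector_derivative)
  qed
  then show ?thesis
    unfolding Z_def by auto
qed

end
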